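(* Let $G$ be a finite inverse semigroup. Given $e\in E(G)$, define $G^e=\{s\in G: ss^*=e\}$ and let $p_e=|G^e|$ be the number of elements of $G^e$. Then $\mathbf{Pr}(G)$ has exactly $$|E(\mathbf{Pr}(G))|=\sum_{e\in E(G)}2^{p_e-1}$$ idempotent elements and exactly $$|\mathbf{Pr}(G)-E(\mathbf{Pr}(G))|=\sum_{e\in E(G)}2^{p_e-2}(p_e-1)$$ non-idempotent elements. In particular, the total number of elements of $\mathbf{Pr}(G)$ is $$|\mathbf{Pr}(G)|=\sum_{e\in E(G)}2^{p_e-1}+\sum_{e\in E(G)}2^{p_e-2}(p_e-1)=\sum_{e\in E(G)}2^{p_e-2}(p_e+1).$$
   Context: For an inverse semigroup $G$, $s^*$ denotes the inverse of $s\in G$ and $E(G)$ the set of idempotents. $\mathbf{Pr}(G)$ is the universal semigroup with one generator $[s]$ for each $s\in G$ and, for all $s,t\in G$, the relations (i) $[s][t][t^*]=[st][t^*]$; (ii) $[s^*][s][t]=[s^*][st]$; (iii) $[s][s^*][s]=[s]$. It is an inverse semigroup, with set of idempotents $E(\mathbf{Pr}(G))$. *)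

theory Defs
  imports Complex_Main
begin

text \<open>
  Semigroups are given by a carrier set and a multiplication that is only meaningful on
  the carrier. The carrier may be empty.
\<close>

locale inverse_semigroup =
  fixes G :: "'a set" and mult :: "'a \<Rightarrow> 'a \<Rightarrow> 'a" (infixl "\<cdot>" 70)
  assumes closed: "s \<in> G \<Longrightarrow> t \<in> G \<Longrightarrow> s \<cdot> t \<in> G"
    and assoc: "r \<in> G \<Longrightarrow> s \<in> G \<Longrightarrow> t \<in> G \<Longrightarrow> r \<cdot> s \<cdot> t = r \<cdot> (s \<cdot> t)"
    and ex1_inverse: "s \<in> G \<Longrightarrow> \<exists>!t. t \<in> G \<and> s \<cdot> t \<cdot> s = s \<and> t \<cdot> s \<cdot> t = t"

definition star :: "'a set \<Rightarrow> ('a \<Rightarrow> 'a \<Rightarrow> 'a) \<Rightarrow> 'a \<Rightarrow> 'a" where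
  "star G m s = (THE t. t \<in> G \<and> m (m s t) s = s \<and> m (m t s) t = t)"

definition idempotents :: "'a set \<Rightarrow> ('a \<Rightarrow> 'a \<Rightarrow> 'a) \<Rightarrow> 'a set" where
  "idempotents G m = {e \<in> G. m e e = e}"

definition range_fibre :: "'a set \<Rightarrow> ('a \<Rightarrow> 'a \<Rightarrow> 'a) \<Rightarrow> 'a \<Rightarrow> 'a set" where
  "range_fibre G m e = {s \<in> G. m s (star G m s) = e}"

text \<open>
  The free semigroup on \<open>G\<close> consists of the non-empty words over \<open>G\<close>; the letter \<open>s\<close> is the
  generator \<open>[s]\<close> (as a one-element list). The relation \<open>pr_eq\<close> is the semigroup
  congruence on it generated by the defining relations.
\<close>

definition words :: "'a set \<Rightarrow> 'a list set" where
  "words G = {w \<in> lists G. w \<noteq> []}"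

inductive pr_eq :: "'a set \<Rightarrow> ('a \<Rightarrow> 'a \<Rightarrow> 'a) \<Rightarrow> 'a list \<Rightarrow> 'a list \<Rightarrow> bool"
  for G :: "'a set" and m :: "'a \<Rightarrow> 'a \<Rightarrow> 'a" where
  rel_right: "s \<in> G \<Longrightarrow> t \<in> G \<Longrightarrow> pr_eq G m [s, t, star G m t] [m s t, star G m t]"
| rel_left: "s \<in> G \<Longrightarrow> t \<in> G \<Longrightarrow> pr_eq G m [star G m s, s, t] [star G m s, m s t]"
| rel_regular: "s \<in> G \<Longrightarrow> pr_eq G m [s, star G m s, s] [s]"
| refl: "w \<in> words G \<Longrightarrow> pr_eq G m w w"
| sym: "pr_eq G m v w \<Longrightarrow> pr_eq G m w v"
| trans: "pr_eq G m u v \<Longrightarrow> pr_eq G m v w \<Longrightarrow> pr_eq G m u w"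
| append: "pr_eq G m u v \<Longrightarrow> pr_eq G m u' v' \<Longrightarrow> pr_eq G m (u @ u') (v @ v')"

definition pr_rel :: "'a set \<Rightarrow> ('a \<Rightarrow> 'a \<Rightarrow> 'a) \<Rightarrow> ('a list \<times> 'a list) set" where
  "pr_rel G m = {(v, w). pr_eq G m v w}"

definition Pr :: "'a set \<Rightarrow> ('a \<Rightarrow> 'a \<Rightarrow> 'a) \<Rightarrow> 'a list set set" where
  "Pr G m = words G // pr_rel G m"

definition pr_mult ::
  "'a set \<Rightarrow> ('a \<Rightarrow> 'a \<Rightarrow> 'a) \<Rightarrow> 'a list set \<Rightarrow> 'a list set \<Rightarrow> 'a list set" where
  "pr_mult G m X Y = (\<Union>v\<in>X. \<Union>w\<in>Y. pr_rel G m `` {v @ w})"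

definition pr_gen :: "'a set \<Rightarrow> ('a \<Rightarrow> 'a \<Rightarrow> 'a) \<Rightarrow> 'a \<Rightarrow> 'a list set" where
  "pr_gen G m s = pr_rel G m `` {[s]}"

lemma (in inverse_semigroup) star_closed:
  assumes "s \<in> G" shows "star G mult s \<in> G"
  using theI'[OF ex1_inverse[OF assms]] by (simp add: star_def)

lemma (in inverse_semigroup) pr_eq_words:
  "pr_eq G mult v w \<Longrightarrow> v \<in> words G \<and> w \<in> words G"
  by (induction rule: pr_eq.induct) (auto simp: words_def closed star_closed)

lemma (in inverse_semigroup) equiv_pr_rel: "equiv (words G) (pr_rel G mult)"
  by (rule equivI)
    (auto simp: pr_rel_def refl_on_def sym_def trans_def
      dest: pr_eq_words intro: pr_eq.refl pr_eq.sym pr_eq.trans)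

lemma (in inverse_semigroup) pr_mult_classes:
  assumes "v \<in> words G" "w \<in> words G"
  shows "pr_mult G mult (pr_rel G mult `` {v}) (pr_rel G mult `` {w}) = pr_rel G mult `` {v @ w}"
  using assms unfolding pr_mult_def pr_rel_def
  by (auto intro: pr_eq.append pr_eq.refl pr_eq.sym pr_eq.trans; 
      blast intro: pr_eq.append pr_eq.refl pr_eq.sym pr_eq.trans)

lemma (in inverse_semigroup) pr_universal:
  fixes H :: "'b set" and n :: "'b \<Rightarrow> 'b \<Rightarrow> 'b" (infixl "\<star>" 70)
    and \<pi> :: "'a \<Rightarrow> 'b"
  assumes H_closed: "\<And>x y. x \<in> H \<Longrightarrow> y \<in> H \<Longrightarrow> x \<star> y \<in> H"
    and H_assoc: "\<And>x y z. x \<in> H \<Longrightarrow> y \<in> H \<Longrightarrow> z \<in> H \<Longrightarrow> x \<star> y \<star> z = x \<star> (y \<star> z)"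
    and \<pi>: "\<And>s. s \<in> G \<Longrightarrow> \<pi> s \<in> H"
    and right: "\<And>s t. s \<in> G \<Longrightarrow> t \<in> G \<Longrightarrow>
      \<pi> s \<star> \<pi> t \<star> \<pi> (star G mult t) = \<pi> (s \<cdot> t) \<star> \<pi> (star G mult t)"
    and left: "\<And>s t. s \<in> G \<Longrightarrow> t \<in> G \<Longrightarrow>
      \<pi> (star G mult s) \<star> \<pi> s \<star> \<pi> t = \<pi> (star G mult s) \<star> \<pi> (s \<cdot> t)"
    and regular: "\<And>s. s \<in> G \<Longrightarrow> \<pi> s \<star> \<pi> (star G mult s) \<star> \<pi> s = \<pi> s"
  shows "\<exists>f. (\<forall>X\<in>Pr G mult. f X \<in> H) \<and> (\<forall>s\<in>G. f (pr_gen G mult s) = \<pi> s) \<and>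
      (\<forall>X\<in>Pr G mult. \<forall>Y\<in>Pr G mult. f (pr_mult G mult X Y) = f X \<star> f Y)"
proof -
  define ev where "ev w = foldl (\<lambda>x s. x \<star> \<pi> s) (\<pi> (hd w)) (tl w)" for w
  have fold_in: "foldl (\<lambda>x s. x \<star> \<pi> s) x w \<in> H" if "x \<in> H" "w \<in> lists G" for x w
    using that by (induction w arbitrary: x) (auto simp: H_closed \<pi>)
  have ev_in: "ev w \<in> H" if "w \<in> words G" for w
    using that unfolding ev_def words_def by (cases w) (auto intro!: fold_in \<pi>)
  have fold_assoc: "x \<star> foldl (\<lambda>x s. x \<star> \<pi> s) y w = foldl (\<lambda>x s. x \<star> \<pi> s) (x \<star> y) w"
    if "x \<in> H" "y \<in> H" "w \<in> lists G" for x y w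
    using that by (induction w arbitrary: y) (auto simp: H_closed \<pi> H_assoc)
  have ev_append: "ev (v @ w) = ev v \<star> ev w" if "v \<in> words G" "w \<in> words G" for v w
  proof -
    from that obtain a v' b w' where "v = a # v'" "w = b # w'" "a \<in> G" "b \<in> G"
      "v' \<in> lists G" "w' \<in> lists G"
      unfolding words_def by (cases v; cases w) auto
    then show ?thesis by (simp add: ev_def fold_assoc fold_in \<pi>)
  qed
  have ev_cong: "pr_eq G mult v w \<Longrightarrow> ev v = ev w" for v w
  proof (induction rule: pr_eq.induct)
    case (append u v u' v')
    then show ?case using pr_eq_words ev_append by metis
  qed (auto simp: ev_def right left regular)
  define f where "f X = ev (SOME w. w \<in> X)" for X
  have f_class: "f (pr_rel G mult `` {w}) = ev w" if "w \<in> words G" for w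
  proof -
    have "w \<in> pr_rel G mult `` {w}" using that by (simp add: pr_rel_def pr_eq.refl)
    then have "(SOME v. v \<in> pr_rel G mult `` {w}) \<in> pr_rel G mult `` {w}" by (rule someI)
    then show ?thesis using ev_cong by (simp add: f_def pr_rel_def)
  qed
  have "f X \<in> H" if "X \<in> Pr G mult" for X
    using that unfolding Pr_def by (auto elim!: quotientE simp: f_class ev_in)
  moreover have "f (pr_gen G mult s) = \<pi> s" if "s \<in> G" for s
    using that f_class[of "[s]"] by (simp add: pr_gen_def words_def ev_def)
  moreover have "f (pr_mult G mult X Y) = f X \<star> f Y"
    if "X \<in> Pr G mult" "Y \<in> Pr G mult" for X Y
  proof -
    from that obtain v w where "X = pr_rel G mult `` {v}" "Y = pr_rel G mult `` {w}"
      "v \<in> words G" "w \<in> words G"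
      unfolding Pr_def by (auto elim!: quotientE)
    moreover from this have "v @ w \<in> words G" by (simp add: words_def)
    ultimately show ?thesis by (simp add: pr_mult_classes f_class ev_append)
  qed
  ultimately show ?thesis by blast
qed

end

theory Submission
  imports Defs
begin

text \<open>
  Put \<open>\<epsilon>\<^sub>a = [a][a\<^sup>\<star>]\<close>. In \<open>Pr(G)\<close> the elements \<open>\<epsilon>\<^sub>a\<close> are commuting idempotents with
  \<open>[s]\<epsilon>\<^sub>a = \<epsilon>\<^sub>s\<^sub>a[s]\<close> and \<open>[s][t] = \<epsilon>\<^sub>s[st]\<close>, so every element is a product of \<open>\<epsilon>\<^sub>a\<close>, \<open>a \<in> A\<close>, and one
  generator \<open>[t]\<close>; here \<open>A\<close> may be chosen with \<open>tt\<^sup>\<star>, t \<in> A\<close> and \<open>aa\<^sup>\<star> = tt\<^sup>\<star>\<close> for all \<open>a \<in> A\<close>.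
  Such pairs \<open>(t, A)\<close> form a semigroup under \<open>(s, A)(t, B) = (st, stt\<^sup>\<star>s\<^sup>\<star>A \<union> sB)\<close> in which
  \<open>s \<mapsto> (s, {ss\<^sup>\<star>, s})\<close> satisfies the defining relations; the universal property then shows that the
  normal form is unique. The pair \<open>(t, A)\<close> is idempotent iff \<open>t\<close> is, that is, iff \<open>t = tt\<^sup>\<star>\<close>. Over
  \<open>e = tt\<^sup>\<star>\<close> there are \<open>2\<close> to the power \<open>p\<^sub>e - 1\<close> sets \<open>A\<close> for \<open>t = e\<close>, and \<open>2\<close> to the power
  \<open>p\<^sub>e - 2\<close> for each of the \<open>p\<^sub>e - 1\<close> other elements \<open>t\<close>.
\<close>

section \<open>Elementary theory of inverse semigroups\<close>

context inverse_semigroup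
begin

abbreviation inv_elt ("_\<^sup>\<star>" [1000] 999) where "s\<^sup>\<star> \<equiv> star G mult s"

abbreviation rg :: "'a \<Rightarrow> 'a" where "rg s \<equiv> s \<cdot> s\<^sup>\<star>"

abbreviation E :: "'a set" where "E \<equiv> idempotents G mult"

lemmas semigroup_simps = assoc closed star_closed

lemma star_inverse:
  assumes "s \<in> G"
  shows "s \<cdot> s\<^sup>\<star> \<cdot> s = s" "s\<^sup>\<star> \<cdot> s \<cdot> s\<^sup>\<star> = s\<^sup>\<star>"
  using theI'[OF ex1_inverse[OF assms]] by (simp_all add: star_def)

lemma star_inverse_right:
  assumes "s \<in> G"
  shows "s \<cdot> (s\<^sup>\<star> \<cdot> s) = s" "s\<^sup>\<star> \<cdot> rg s = s\<^sup>\<star>"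
  using star_inverse[OF assms] assms by (simp_all add: semigroup_simps)

lemma star_eqI:
  assumes "s \<in> G" "t \<in> G" "s \<cdot> t \<cdot> s = s" "t \<cdot> s \<cdot> t = t"
  shows "s\<^sup>\<star> = t"
  using ex1_inverse[OF assms(1)] assms star_inverse[OF assms(1)] star_closed[OF assms(1)] by blast

lemma star_star: "s \<in> G \<Longrightarrow> (s\<^sup>\<star>)\<^sup>\<star> = s"
  by (rule star_eqI) (auto simp: star_closed star_inverse)

lemma idempotents_in: "e \<in> E \<Longrightarrow> e \<in> G" and idempotents_idem: "e \<in> E \<Longrightarrow> e \<cdot> e = e"
  by (auto simp: idempotents_def)

lemma star_idempotent: "e \<in> E \<Longrightarrow> e\<^sup>\<star> = e"
  by (rule star_eqI) (auto simp: idempotents_def)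

text \<open>By uniqueness of inverses, the inverse \<open>x\<close> of \<open>e \<cdot> f\<close>
  equals \<open>f \<cdot> (x \<cdot> e)\<close>, which makes \<open>x\<close> idempotent. An
  idempotent is its own inverse, so \<open>e \<cdot> f = x\<close>.\<close>

lemma mult_idempotents:
  assumes "e \<in> E" "f \<in> E"
  shows "e \<cdot> f \<in> E"
proof -
  note [simp] = idempotents_in[OF assms(1)] idempotents_in[OF assms(2)]
  define x where "x = (e \<cdot> f)\<^sup>\<star>"
  have x: "x \<in> G" by (simp add: x_def closed star_closed)
  have inv: "e \<cdot> f \<cdot> x \<cdot> (e \<cdot> f) = e \<cdot> f" "x \<cdot> (e \<cdot> f) \<cdot> x = x"
    using star_inverse[of "e \<cdot> f"] by (simp_all add: x_def closed)
  have ee: "e \<cdot> (e \<cdot> y) = e \<cdot> y" "f \<cdot> (f \<cdot> y) = f \<cdot> y" if "y \<in> G" for y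
    using that assms by (metis assoc idempotents_in idempotents_idem)+
  have xx: "x \<cdot> (e \<cdot> (f \<cdot> (x \<cdot> y))) = x \<cdot> y" if "y \<in> G" for y
    using that inv(2) x by (metis assoc closed \<open>e \<in> G\<close> \<open>f \<in> G\<close>)
  have "x = f \<cdot> (x \<cdot> e)"
    unfolding x_def
  proof (rule star_eqI)
    show "e \<cdot> f \<cdot> (f \<cdot> ((e \<cdot> f)\<^sup>\<star> \<cdot> e)) \<cdot> (e \<cdot> f) = e \<cdot> f"
      using inv(1) x by (simp add: semigroup_simps ee flip: x_def)
    show "f \<cdot> ((e \<cdot> f)\<^sup>\<star> \<cdot> e) \<cdot> (e \<cdot> f) \<cdot> (f \<cdot> ((e \<cdot> f)\<^sup>\<star> \<cdot> e)) = f \<cdot> ((e \<cdot> f)\<^sup>\<star> \<cdot> e)"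
      using x by (simp add: semigroup_simps ee xx flip: x_def)
  qed (simp_all add: semigroup_simps)
  then have "x \<cdot> x = f \<cdot> (x \<cdot> e) \<cdot> (f \<cdot> (x \<cdot> e))" by simp
  also have "\<dots> = f \<cdot> (x \<cdot> e)" using x by (simp add: semigroup_simps xx)
  finally have "x \<in> E" using x \<open>x = f \<cdot> (x \<cdot> e)\<close> by (simp add: idempotents_def)
  moreover have "x\<^sup>\<star> = e \<cdot> f" by (simp add: x_def star_star closed)
  ultimately show ?thesis using star_idempotent by metis
qed

text \<open>Since \<open>e \<cdot> f\<close> and \<open>f \<cdot> e\<close> are idempotent, both of
  them are the inverse of \<open>e \<cdot> f\<close>.\<close>

lemma idempotents_commute:
  assumes "e \<in> E" "f \<in> E"
  shows "e \<cdot> f = f \<cdot> e"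
proof -
  note [simp] = idempotents_in[OF assms(1)] idempotents_in[OF assms(2)]
  have ee: "e \<cdot> (e \<cdot> y) = e \<cdot> y" "f \<cdot> (f \<cdot> y) = f \<cdot> y" if "y \<in> G" for y
    using that assms by (metis assoc idempotents_in idempotents_idem)+
  have "(e \<cdot> f)\<^sup>\<star> = f \<cdot> e"
    using idempotents_idem[OF mult_idempotents[OF assms]]
      idempotents_idem[OF mult_idempotents[OF assms(2,1)]]
    by (intro star_eqI) (simp_all add: semigroup_simps ee)
  then show ?thesis using star_idempotent[OF mult_idempotents[OF assms]] by simp
qed

lemma rg_closed: "s \<in> G \<Longrightarrow> rg s \<in> G"
  by (simp add: closed star_closed)

lemma rg_idempotent: "s \<in> G \<Longrightarrow> rg s \<in> E"
  by (simp add: idempotents_def semigroup_simps) (metis assoc closed star_closed star_inverse(1))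

lemma source_idempotent: "s \<in> G \<Longrightarrow> s\<^sup>\<star> \<cdot> s \<in> E"
  using rg_idempotent[of "s\<^sup>\<star>"] by (simp add: star_star star_closed)

lemma rg_of_idempotent: "e \<in> E \<Longrightarrow> rg e = e"
  by (simp add: star_idempotent idempotents_idem)

lemma rg_mult_self: "s \<in> G \<Longrightarrow> rg s \<cdot> s = s"
  by (rule star_inverse)

text \<open>The idempotents \<open>rg t\<close> and \<open>s\<^sup>\<star> \<cdot> s\<close>
  commute, which brings the latter next to \<open>s\<close>, where it is absorbed.\<close>

lemma mult_rg_source:
  assumes "s \<in> G" "t \<in> G"
  shows "s \<cdot> rg t \<cdot> (s\<^sup>\<star> \<cdot> s) = s \<cdot> rg t"
proof -
  have "s \<cdot> rg t \<cdot> (s\<^sup>\<star> \<cdot> s) = s \<cdot> (rg t \<cdot> (s\<^sup>\<star> \<cdot> s))" using assms by (simp add: semigroup_simps)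
  also have "\<dots> = s \<cdot> ((s\<^sup>\<star> \<cdot> s) \<cdot> rg t)"
    using assms by (simp only: idempotents_commute[OF rg_idempotent source_idempotent])
  also have "\<dots> = s \<cdot> s\<^sup>\<star> \<cdot> s \<cdot> rg t" using assms by (simp add: semigroup_simps)
  finally show ?thesis using assms by (simp add: star_inverse)
qed

lemma star_mult:
  assumes "s \<in> G" "t \<in> G"
  shows "(s \<cdot> t)\<^sup>\<star> = t\<^sup>\<star> \<cdot> s\<^sup>\<star>"
proof (rule star_eqI)
  have "s \<cdot> t \<cdot> (t\<^sup>\<star> \<cdot> s\<^sup>\<star>) \<cdot> (s \<cdot> t) = s \<cdot> rg t \<cdot> (s\<^sup>\<star> \<cdot> s) \<cdot> t"
    using assms by (simp add: semigroup_simps)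
  also have "\<dots> = s \<cdot> rg t \<cdot> t" using assms by (simp only: mult_rg_source)
  also have "\<dots> = s \<cdot> (rg t \<cdot> t)" using assms by (simp add: semigroup_simps)
  finally show "s \<cdot> t \<cdot> (t\<^sup>\<star> \<cdot> s\<^sup>\<star>) \<cdot> (s \<cdot> t) = s \<cdot> t" using assms by (simp add: star_inverse)
  have "t\<^sup>\<star> \<cdot> s\<^sup>\<star> \<cdot> (s \<cdot> t) \<cdot> (t\<^sup>\<star> \<cdot> s\<^sup>\<star>) = t\<^sup>\<star> \<cdot> rg (s\<^sup>\<star>) \<cdot> ((t\<^sup>\<star>)\<^sup>\<star> \<cdot> t\<^sup>\<star>) \<cdot> s\<^sup>\<star>"
    using assms by (simp add: semigroup_simps star_star)
  also have "\<dots> = t\<^sup>\<star> \<cdot> rg (s\<^sup>\<star>) \<cdot> s\<^sup>\<star>" using assms by (simp only: mult_rg_source star_closed)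
  also have "\<dots> = t\<^sup>\<star> \<cdot> (rg (s\<^sup>\<star>) \<cdot> s\<^sup>\<star>)" using assms by (simp add: semigroup_simps)
  finally show "t\<^sup>\<star> \<cdot> s\<^sup>\<star> \<cdot> (s \<cdot> t) \<cdot> (t\<^sup>\<star> \<cdot> s\<^sup>\<star>) = t\<^sup>\<star> \<cdot> s\<^sup>\<star>"
    using assms by (simp add: star_inverse star_closed)
qed (use assms in \<open>simp_all add: semigroup_simps\<close>)

lemma rg_mult: "s \<in> G \<Longrightarrow> t \<in> G \<Longrightarrow> rg (s \<cdot> t) = s \<cdot> rg t \<cdot> s\<^sup>\<star>"
  by (simp add: star_mult semigroup_simps)

text \<open>The rule for moving an idempotent past \<open>s\<close>: it gets conjugated by
  \<open>s\<close>, which turns \<open>rg t\<close> into \<open>rg (s \<cdot> t)\<close>.\<close>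

lemma rg_mult_left:
  assumes "s \<in> G" "t \<in> G"
  shows "rg (s \<cdot> t) \<cdot> s = s \<cdot> rg t"
  using mult_rg_source[OF assms] assms unfolding rg_mult[OF assms] by (simp add: semigroup_simps)

text \<open>The conjugate \<open>rg (s \<cdot> t)\<close> of \<open>rg t\<close> ends in
  \<open>s\<^sup>\<star>\<close>, which absorbs \<open>rg s\<close>.\<close>

lemma rg_mult_rg:
  assumes "s \<in> G" "t \<in> G"
  shows "rg (s \<cdot> t) \<cdot> rg s = rg (s \<cdot> t)"
proof -
  have "rg (s \<cdot> t) \<cdot> rg s = s \<cdot> rg t \<cdot> (s\<^sup>\<star> \<cdot> s \<cdot> s\<^sup>\<star>)"
    using assms unfolding rg_mult[OF assms] by (simp add: semigroup_simps)
  then show ?thesis using assms by (simp add: star_inverse rg_mult)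
qed

end

section \<open>Calculus of generators acting as operators\<close>

text \<open>
  Realising \<open>Pr(G)\<close> by operators makes the multiplication associative without carrier conditions.
\<close>

locale operator_representation = inverse_semigroup +
  fixes T :: "'a \<Rightarrow> 'b \<Rightarrow> 'b"
  assumes T_right: "s \<in> G \<Longrightarrow> t \<in> G \<Longrightarrow> T s (T t (T (star G mult t) X)) = T (s \<cdot> t) (T (star G mult t) X)"
    and T_left: "s \<in> G \<Longrightarrow> t \<in> G \<Longrightarrow> T (star G mult s) (T s (T t X)) = T (star G mult s) (T (s \<cdot> t) X)"
    and T_regular: "s \<in> G \<Longrightarrow> T s (T (star G mult s) (T s X)) = T s X"
begin

definition eps :: "'a \<Rightarrow> 'b \<Rightarrow> 'b" where "eps a X = T a (T (a\<^sup>\<star>) X)"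

lemma T_left_star:
  assumes "s \<in> G" "t \<in> G"
  shows "T s (T (s\<^sup>\<star>) (T t X)) = T s (T (s\<^sup>\<star> \<cdot> t) X)"
  using T_left[of "s\<^sup>\<star>" t X] assms by (simp add: star_star star_closed)

lemma T_regular_star: "s \<in> G \<Longrightarrow> T (s\<^sup>\<star>) (T s (T (s\<^sup>\<star>) X)) = T (s\<^sup>\<star>) X"
  using T_regular[of "s\<^sup>\<star>" X] by (simp add: star_star star_closed)

text \<open>Regularity inserts further factors for \<open>s\<close> and
  \<open>s\<^sup>\<star>\<close> behind the leading one; \<open>T_left\<close> then multiplies these
  into \<open>t\<close> one after the other.\<close>

lemma T_star_rg:
  assumes "s \<in> G" "t \<in> G"
  shows "T (s\<^sup>\<star>) (T (rg s \<cdot> t) X) = T (s\<^sup>\<star>) (T t X)"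
proof -
  have "T (s\<^sup>\<star>) (T t X) = T (s\<^sup>\<star>) (T s (T (s\<^sup>\<star>) (T t X)))" using assms by (simp add: T_regular_star)
  also have "\<dots> = T (s\<^sup>\<star>) (T s (T (s\<^sup>\<star> \<cdot> t) X))" using assms by (simp add: T_left_star)
  also have "\<dots> = T (s\<^sup>\<star>) (T (s \<cdot> (s\<^sup>\<star> \<cdot> t)) X)" using assms by (simp add: T_left semigroup_simps)
  finally show ?thesis using assms by (simp add: semigroup_simps)
qed

text \<open>The right relation merges \<open>s\<close> with \<open>a\<close>, regularity of
  \<open>s \<cdot> a\<close> creates the new \<open>eps\<close>, and the left relation multiplies
  the surplus \<open>s \<cdot> a\<close> into \<open>a\<^sup>\<star>\<close>. The result
  \<open>rg (s \<cdot> a) \<cdot> s\<close> acts like \<open>s\<close> behind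
  \<open>T ((s \<cdot> a)\<^sup>\<star>)\<close>.\<close>

lemma T_eps:
  assumes "s \<in> G" "a \<in> G"
  shows "T s (eps a X) = eps (s \<cdot> a) (T s X)"
proof -
  have sa: "s \<cdot> a \<in> G" using assms by (simp add: closed)
  have "T s (eps a X) = T (s \<cdot> a) (T (a\<^sup>\<star>) X)" using assms by (simp add: eps_def T_right)
  also have "\<dots> = T (s \<cdot> a) (T ((s \<cdot> a)\<^sup>\<star>) (T (s \<cdot> a) (T (a\<^sup>\<star>) X)))" using sa by (simp add: T_regular)
  also have "\<dots> = T (s \<cdot> a) (T ((s \<cdot> a)\<^sup>\<star>) (T (s \<cdot> a \<cdot> a\<^sup>\<star>) X))"
    using sa assms by (simp add: T_left star_closed)
  also have "s \<cdot> a \<cdot> a\<^sup>\<star> = rg (s \<cdot> a) \<cdot> s"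
    using assms by (simp add: rg_mult_left) (simp add: semigroup_simps)
  also have "T ((s \<cdot> a)\<^sup>\<star>) (T (rg (s \<cdot> a) \<cdot> s) X) = T ((s \<cdot> a)\<^sup>\<star>) (T s X)"
    using sa assms by (simp only: T_star_rg)
  finally show ?thesis by (simp add: eps_def)
qed

text \<open>With \<open>e\<^sup>\<star> = e\<close>, three factors \<open>T e\<close> reduce to two
  by \<open>T_left\<close> and to one by \<open>T_regular\<close>.\<close>

lemma T_idempotent:
  assumes "e \<in> E"
  shows "T e (T e X) = T e X"
  using T_left[of e e X] T_regular[of e X] assms
  by (simp add: star_idempotent idempotents_in idempotents_idem)

lemma eps_idempotent: "e \<in> E \<Longrightarrow> eps e X = T e X"
  by (simp add: eps_def star_idempotent T_idempotent)

text \<open>Regularity puts a \<open>T (s\<^sup>\<star>)\<close> behind \<open>T s\<close>; in its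
  presence the right relation splits \<open>s = rg s \<cdot> s\<close>.\<close>

lemma T_rg:
  assumes "s \<in> G"
  shows "T (rg s) (T s X) = T s X"
proof -
  have "T s X = T s (T (s\<^sup>\<star>) (T s X))" using assms by (simp add: T_regular)
  also have "\<dots> = T (rg s \<cdot> s) (T (s\<^sup>\<star>) (T s X))" using assms by (simp add: rg_mult_self)
  also have "\<dots> = T (rg s) (T s (T (s\<^sup>\<star>) (T s X)))" using assms by (simp add: T_right rg_closed)
  also have "\<dots> = T (rg s) (T s X)" using assms by (simp add: T_regular)
  finally show ?thesis by simp
qed

lemma T_rg_eps: "a \<in> G \<Longrightarrow> T (rg a) (eps a X) = eps a X"
  by (simp add: eps_def T_rg)

lemma eps_eps: "a \<in> G \<Longrightarrow> eps a (eps a X) = eps a X"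
  by (simp add: eps_def T_regular)

text \<open>Doubling \<open>T e\<close> lets the left relation replace \<open>f\<close> by
  \<open>e \<cdot> f\<close>; doubling \<open>T (e \<cdot> f)\<close> then lets the right relation
  absorb \<open>e\<close>.\<close>

lemma T_idempotents_mult:
  assumes "e \<in> E" "f \<in> E"
  shows "T e (T f X) = T (e \<cdot> f) X"
proof -
  have ef: "e \<cdot> f \<in> E" using assms by (rule mult_idempotents)
  have e: "T e (T f X) = T e (T (e \<cdot> f) X)"
    using T_left[of e f X] assms by (simp add: star_idempotent idempotents_in T_idempotent)
  have "e \<cdot> (e \<cdot> f) = e \<cdot> f" using assms by (metis assoc idempotents_in idempotents_idem)
  then have "T e (T (e \<cdot> f) X) = T (e \<cdot> f) X"
    using T_right[of e "e \<cdot> f" X] assms(1) ef by (simp add: star_idempotent idempotents_in T_idempotent)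
  with e show ?thesis by simp
qed

text \<open>Moving \<open>eps b\<close> out through \<open>a\<^sup>\<star>\<close> and
  \<open>a\<close> gives it the index \<open>rg a \<cdot> b\<close>, so an exchange costs a factor
  \<open>T (rg a)\<close>. After two exchanges the factors \<open>T (rg b)\<close> and
  \<open>T (rg a)\<close> stand in front of \<open>eps b\<close>; they commute, and
  \<open>eps b\<close> absorbs \<open>T (rg b)\<close>.\<close>

lemma eps_commute:
  assumes a: "a \<in> G" and b: "b \<in> G"
  shows "eps a (eps b X) = eps b (eps a X)"
proof -
  have swap: "eps a (eps b X) = T (rg a) (eps b (eps a X))" if "a \<in> G" "b \<in> G" for a b X
  proof -
    have "eps a (eps b X) = eps (rg a \<cdot> b) (eps a X)"
      using that by (simp add: eps_def[of a] T_eps semigroup_simps)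
    also have "\<dots> = eps (rg a \<cdot> b) (T (rg a) (eps a X))" using that by (simp add: T_rg_eps)
    also have "\<dots> = T (rg a) (eps b (eps a X))" using that by (simp add: T_eps rg_closed)
    finally show ?thesis .
  qed
  have idem: "rg a \<in> E" "rg b \<in> E" using a b by (simp_all add: rg_idempotent)
  have comm: "T (rg a) (T (rg b) Y) = T (rg b) (T (rg a) Y)" for Y
    using idem by (simp add: T_idempotents_mult idempotents_commute)
  have "eps b (eps a X) = T (rg b) (eps a (eps b X))" by (rule swap[OF b a])
  also have "\<dots> = T (rg b) (T (rg a) (eps b (eps a X)))" using swap[OF a b] by simp
  also have "\<dots> = T (rg a) (eps b (eps a X))" using b by (simp add: T_rg_eps flip: comm)
  also have "\<dots> = eps a (eps b X)" using swap[OF a b] by simp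
  finally show ?thesis by simp
qed

text \<open>This adapts the index of an \<open>eps\<close> to the range of the generator behind it.
  It holds because \<open>T t\<close> absorbs \<open>T (rg t)\<close>, which is itself an
  \<open>eps\<close> and hence commutes with \<open>eps a\<close>.\<close>

lemma eps_rg_mult:
  assumes "a \<in> G" "t \<in> G"
  shows "eps a (T t X) = eps (rg t \<cdot> a) (T t X)"
proof -
  have e: "rg t \<in> E" using assms by (simp add: rg_idempotent)
  have "eps (rg t \<cdot> a) (T t X) = T (rg t) (eps a (T t X))"
    using assms by (simp add: T_eps T_rg rg_closed)
  also have "\<dots> = eps a (T (rg t) (T t X))"
    using assms e by (metis eps_idempotent eps_commute rg_closed)
  finally show ?thesis using assms by (simp add: T_rg)
qed

text \<open>Regularity and the left relation give \<open>eps s (T (s \<cdot> t) X)\<close>. The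
  index is then adapted and the redundant \<open>eps (rg (s \<cdot> t))\<close> added, so that the
  indices are exactly the two elements that \<open>expansion_gen_mult\<close> puts into the set
  besides the translate of \<open>B\<close>.\<close>

lemma T_mult:
  assumes "s \<in> G" "t \<in> G"
  shows "T s (T t X) = eps (rg (s \<cdot> t)) (eps (rg (s \<cdot> t) \<cdot> s) (T (s \<cdot> t) X))"
proof -
  have st: "s \<cdot> t \<in> G" using assms by (simp add: closed)
  have "T s (T t X) = T s (T (s\<^sup>\<star>) (T s (T t X)))" using assms by (simp add: T_regular)
  also have "\<dots> = eps s (T (s \<cdot> t) X)" using assms by (simp add: T_left eps_def)
  also have "\<dots> = eps (rg (s \<cdot> t) \<cdot> s) (T (s \<cdot> t) X)" using assms st by (simp only: eps_rg_mult)
  also have "T (s \<cdot> t) X = eps (rg (s \<cdot> t)) (T (s \<cdot> t) X)"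
    using st by (simp add: eps_idempotent rg_idempotent T_rg)
  finally show ?thesis using assms st by (simp add: eps_commute[of _ "rg (s \<cdot> t)"] closed rg_closed)
qed

section \<open>Finite products of \<open>eps\<close>\<close>

lemma eps_foldr:
  assumes "a \<in> G" "set xs \<subseteq> G"
  shows "eps a (foldr eps xs X) = foldr eps xs (eps a X)"
  using assms by (induction xs) (simp_all add: eps_commute[of a])

lemma eps_foldr_member:
  assumes "a \<in> set xs" "set xs \<subseteq> G"
  shows "eps a (foldr eps xs X) = foldr eps xs X"
  using assms
proof (induction xs)
  case (Cons x xs)
  then show ?case by (cases "a = x") (auto simp: eps_eps eps_commute[of a x])
qed simp

lemma foldr_eps_subset:
  assumes "set ys \<subseteq> set xs" "set xs \<subseteq> G"
  shows "foldr eps ys (foldr eps xs X) = foldr eps xs X"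
  using assms by (induction ys) (simp_all add: eps_foldr_member)

lemma foldr_eps_commute:
  assumes "set ys \<subseteq> G" "set xs \<subseteq> G"
  shows "foldr eps ys (foldr eps xs X) = foldr eps xs (foldr eps ys X)"
  using assms by (induction ys) (simp_all add: eps_foldr)

text \<open>The two products commute and, having the same indices, each absorbs the other.\<close>

lemma foldr_eps_cong_set:
  assumes "set xs = set ys" "set xs \<subseteq> G"
  shows "foldr eps xs X = foldr eps ys X"
  using assms by (metis foldr_eps_commute foldr_eps_subset order_refl)

lemma T_foldr_eps:
  assumes "s \<in> G" "set xs \<subseteq> G"
  shows "T s (foldr eps xs X) = foldr eps (map ((\<cdot>) s) xs) (T s X)"
  using assms by (induction xs) (simp_all add: T_eps)

end

section \<open>The semigroup of pairs\<close>

context inverse_semigroup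
begin

text \<open>
  The pair \<open>(t, A)\<close> stands for the product of all
  \<open>[a][a\<^sup>\<star>]\<close> with \<open>a \<in> A\<close>, followed by \<open>[t]\<close>.
\<close>

definition expansion :: "('a \<times> 'a set) set" where
  "expansion = (SIGMA t:G. {A. {rg t, t} \<subseteq> A \<and> A \<subseteq> range_fibre G mult (rg t)})"

text \<open>For a group \<open>G\<close> the factor \<open>rg (fst x \<cdot> fst y)\<close> is the
  identity, and this is the product of Szendrei's expansion. In general that factor cuts the first
  set down to the range of the product.\<close>

definition expansion_mult :: "'a \<times> 'a set \<Rightarrow> 'a \<times> 'a set \<Rightarrow> 'a \<times> 'a set" (infixl "\<otimes>" 70) where
  "x \<otimes> y = (fst x \<cdot> fst y, (\<cdot>) (rg (fst x \<cdot> fst y)) ` snd x \<union> (\<cdot>) (fst x) ` snd y)"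

definition expansion_gen :: "'a \<Rightarrow> 'a \<times> 'a set" where
  "expansion_gen s = (s, {rg s, s})"

lemma rg_rg: "s \<in> G \<Longrightarrow> rg (rg s) = rg s"
  by (simp add: rg_of_idempotent rg_idempotent)

lemma rg_absorb:
  assumes "s \<in> G" "t \<in> G" "rg s = rg t"
  shows "rg t \<cdot> s = s"
  using rg_mult_self[OF assms(1)] assms(3) by simp

lemma rg_mult_cong:
  assumes "s \<in> G" "b \<in> G" "t \<in> G" "rg b = rg t"
  shows "rg (s \<cdot> b) = rg (s \<cdot> t)"
  using assms by (simp add: rg_mult)

text \<open>Keeps the restricted first set of a product in the fibre of the range of
  \<open>s \<cdot> t\<close>; \<open>rg_mult_cong\<close> does the same for the translated second
  set.\<close>

lemma rg_rg_mult:
  assumes "s \<in> G" "t \<in> G" "a \<in> G" "rg a = rg s"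
  shows "rg (rg (s \<cdot> t) \<cdot> a) = rg (s \<cdot> t)"
proof -
  have st: "s \<cdot> t \<in> G" using assms by (simp add: closed)
  have "rg (rg (s \<cdot> t) \<cdot> a) = rg (rg (s \<cdot> t) \<cdot> rg s)"
    using assms st by (intro rg_mult_cong) (simp_all add: rg_closed rg_rg)
  then show ?thesis using assms st by (simp add: rg_mult_rg rg_rg)
qed

lemma expansion_mult_closed:
  assumes "x \<in> expansion" "y \<in> expansion"
  shows "x \<otimes> y \<in> expansion"
proof -
  obtain s A t B where [simp]: "x = (s, A)" "y = (t, B)" by fastforce
  have x: "s \<in> G" "rg s \<in> A" "s \<in> A" "\<And>a. a \<in> A \<Longrightarrow> a \<in> G" "\<And>a. a \<in> A \<Longrightarrow> rg a = rg s"
    and y: "t \<in> G" "rg t \<in> B" "t \<in> B" "\<And>b. b \<in> B \<Longrightarrow> b \<in> G" "\<And>b. b \<in> B \<Longrightarrow> rg b = rg t"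
    using assms by (auto simp: expansion_def range_fibre_def)
  have "rg (s \<cdot> t) \<in> (\<cdot>) (rg (s \<cdot> t)) ` A"
    using rg_mult_rg[OF x(1) y(1)] x(2) by (metis image_eqI)
  moreover have "(\<cdot>) (rg (s \<cdot> t)) ` A \<subseteq> range_fibre G mult (rg (s \<cdot> t))"
  proof
    fix c assume "c \<in> (\<cdot>) (rg (s \<cdot> t)) ` A"
    then obtain a where "a \<in> A" "c = rg (s \<cdot> t) \<cdot> a" by blast
    then show "c \<in> range_fibre G mult (rg (s \<cdot> t))"
      using rg_rg_mult[OF x(1) y(1) x(4,5)] x(1,4) y(1)
      by (simp add: range_fibre_def closed star_closed)
  qed
  moreover have "(\<cdot>) s ` B \<subseteq> range_fibre G mult (rg (s \<cdot> t))"
  proof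
    fix c assume "c \<in> (\<cdot>) s ` B"
    then obtain b where "b \<in> B" "c = s \<cdot> b" by blast
    then show "c \<in> range_fibre G mult (rg (s \<cdot> t))"
      using rg_mult_cong[OF x(1) y(4) y(1) y(5)] x(1) y(4)
      by (simp add: range_fibre_def closed star_closed)
  qed
  moreover have "s \<cdot> t \<in> (\<cdot>) s ` B" using y(3) by blast
  ultimately show ?thesis using x(1) y(1) by (simp add: expansion_def expansion_mult_def closed)
qed

text \<open>Each factor contributes one part of the set on either side. With \<open>r\<close> the
  range of the triple product, the parts agree because \<open>r\<close> absorbs
  \<open>rg (s \<cdot> t)\<close> for \<open>A\<close>, because
  \<open>r \<cdot> s = s \<cdot> rg (t \<cdot> u)\<close> for \<open>B\<close>, and by associativity
  in \<open>G\<close> for \<open>C\<close>.\<close>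

lemma expansion_mult_assoc:
  assumes "x \<in> expansion" "y \<in> expansion" "z \<in> expansion"
  shows "x \<otimes> y \<otimes> z = x \<otimes> (y \<otimes> z)"
proof -
  obtain s A t B u C where [simp]: "x = (s, A)" "y = (t, B)" "z = (u, C)" by (metis surj_pair)
  have G: "s \<in> G" "t \<in> G" "u \<in> G" "A \<subseteq> G" "B \<subseteq> G" "C \<subseteq> G"
    using assms by (auto simp: expansion_def range_fibre_def)
  have tu: "t \<cdot> u \<in> G" and st: "s \<cdot> t \<in> G" using G by (auto simp: closed)
  define r where "r = rg (s \<cdot> (t \<cdot> u))"
  have r: "r \<in> G" "rg (s \<cdot> t \<cdot> u) = r" using G tu by (auto simp: r_def rg_closed closed assoc)
  have rr: "r \<cdot> rg (s \<cdot> t) = r" using G st rg_mult_rg[OF st \<open>u \<in> G\<close>] r(2) by simp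
  have rs: "r \<cdot> s = s \<cdot> rg (t \<cdot> u)" using G tu by (simp only: r_def rg_mult_left)
  have 1: "(\<cdot>) r ` (\<cdot>) (rg (s \<cdot> t)) ` A = (\<cdot>) r ` A"
    unfolding image_image
  proof (rule image_cong)
    fix a assume "a \<in> A"
    then have "a \<in> G" using G by auto
    then have "r \<cdot> (rg (s \<cdot> t) \<cdot> a) = r \<cdot> rg (s \<cdot> t) \<cdot> a"
      using r st by (simp only: assoc rg_closed)
    then show "r \<cdot> (rg (s \<cdot> t) \<cdot> a) = r \<cdot> a" using rr by simp
  qed simp
  have 2: "(\<cdot>) r ` (\<cdot>) s ` B = (\<cdot>) s ` (\<cdot>) (rg (t \<cdot> u)) ` B"
    unfolding image_image
  proof (rule image_cong)
    fix b assume "b \<in> B"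
    then have "b \<in> G" using G by auto
    then have "r \<cdot> (s \<cdot> b) = r \<cdot> s \<cdot> b" "s \<cdot> (rg (t \<cdot> u) \<cdot> b) = s \<cdot> rg (t \<cdot> u) \<cdot> b"
      using r G tu by (simp_all only: assoc rg_closed)
    then show "r \<cdot> (s \<cdot> b) = s \<cdot> (rg (t \<cdot> u) \<cdot> b)" using rs by simp
  qed simp
  have 3: "(\<cdot>) (s \<cdot> t) ` C = (\<cdot>) s ` (\<cdot>) t ` C"
    unfolding image_image using G by (intro image_cong) (auto simp: assoc)
  have "s \<cdot> t \<cdot> u = s \<cdot> (t \<cdot> u)" using G by (simp add: assoc)
  then show ?thesis
    using 1 2 3 r(2)
    by (simp add: expansion_mult_def image_Un Un_assoc flip: r_def)
qed

section \<open>Generators and defining relations in \<open>expansion\<close>\<close>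

lemma expansion_gen_closed: "s \<in> G \<Longrightarrow> expansion_gen s \<in> expansion"
  by (auto simp: expansion_def expansion_gen_def range_fibre_def rg_closed rg_rg)

lemma expansion_gen_mult:
  assumes "s \<in> G" "t \<in> G"
  shows "expansion_gen s \<otimes> (t, B) = (s \<cdot> t, {rg (s \<cdot> t), rg (s \<cdot> t) \<cdot> s} \<union> (\<cdot>) s ` B)"
  using assms by (simp add: expansion_mult_def expansion_gen_def rg_mult_rg)

lemma expansion_gen_gen:
  assumes "s \<in> G" "t \<in> G"
  shows "expansion_gen s \<otimes> expansion_gen t = (s \<cdot> t, {rg (s \<cdot> t), s \<cdot> rg t, s \<cdot> t})"
  using assms expansion_gen_mult[OF assms] by (auto simp: rg_mult_left expansion_gen_def[of t])

lemma expansion_right: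
  assumes "s \<in> G" "t \<in> G"
  shows "expansion_gen s \<otimes> expansion_gen t \<otimes> expansion_gen (t\<^sup>\<star>)
    = expansion_gen (s \<cdot> t) \<otimes> expansion_gen (t\<^sup>\<star>)"
proof -
  note G = assms star_closed[OF assms(2)] closed[OF assms] rg_closed[OF assms(2)]
  have r: "rg (s \<cdot> rg t) = rg (s \<cdot> t)"
    using G by (intro rg_mult_cong) (simp_all add: rg_rg)
  have "expansion_gen s \<otimes> expansion_gen t \<otimes> expansion_gen (t\<^sup>\<star>)
    = expansion_gen s \<otimes> (expansion_gen t \<otimes> expansion_gen (t\<^sup>\<star>))"
    using G by (simp add: expansion_mult_assoc expansion_gen_closed)
  also have "expansion_gen t \<otimes> expansion_gen (t\<^sup>\<star>) = (rg t, {rg t, t})"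
    using G by (auto simp: expansion_gen_gen rg_rg star_star) (simp_all add: star_inverse flip: assoc)
  also have "expansion_gen s \<otimes> (rg t, {rg t, t})
    = (s \<cdot> rg t, {rg (s \<cdot> t), s \<cdot> rg t, s \<cdot> t})"
    using G by (auto simp: expansion_gen_mult r rg_mult_left)
  also have "\<dots> = expansion_gen (s \<cdot> t) \<otimes> expansion_gen (t\<^sup>\<star>)"
  proof -
    have "s \<cdot> t \<cdot> t\<^sup>\<star> = s \<cdot> rg t" using G by (simp add: assoc)
    moreover have "s \<cdot> t \<cdot> (t\<^sup>\<star> \<cdot> t) = s \<cdot> t" using G by (simp add: semigroup_simps star_inverse_right)
    ultimately show ?thesis using G by (auto simp: expansion_gen_gen r star_star)
  qed
  finally show ?thesis .
qed

lemma expansion_left: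
  assumes "s \<in> G" "t \<in> G"
  shows "expansion_gen (s\<^sup>\<star>) \<otimes> expansion_gen s \<otimes> expansion_gen t
    = expansion_gen (s\<^sup>\<star>) \<otimes> expansion_gen (s \<cdot> t)"
proof -
  note G = assms star_closed[OF assms(1)] closed[OF assms] rg_closed[OF assms(2)]
    rg_closed[OF closed[OF assms]]
  have r: "rg (s \<cdot> rg t) = rg (s \<cdot> t)"
    using G by (intro rg_mult_cong) (simp_all add: rg_rg)
  have "expansion_gen (s\<^sup>\<star>) \<otimes> expansion_gen s \<otimes> expansion_gen t
    = expansion_gen (s\<^sup>\<star>) \<otimes> (expansion_gen s \<otimes> expansion_gen t)"
    using G by (simp add: expansion_mult_assoc expansion_gen_closed)
  also have "\<dots> = (s\<^sup>\<star> \<cdot> (s \<cdot> t), {rg (s\<^sup>\<star> \<cdot> (s \<cdot> t)), s\<^sup>\<star> \<cdot> rg (s \<cdot> t), s\<^sup>\<star> \<cdot> (s \<cdot> rg t), s\<^sup>\<star> \<cdot> (s \<cdot> t)})"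
    using G by (auto simp: expansion_gen_gen expansion_gen_mult rg_mult_left)
  \<comment> \<open>The left side carries one element more than the right side. Being idempotent, it
    is its own range, and this range is already in the set.\<close>
  also have "s\<^sup>\<star> \<cdot> (s \<cdot> rg t) = rg (s\<^sup>\<star> \<cdot> (s \<cdot> t))"
  proof -
    have "s\<^sup>\<star> \<cdot> (s \<cdot> rg t) = s\<^sup>\<star> \<cdot> s \<cdot> rg t" using G by (simp add: assoc)
    moreover have "s\<^sup>\<star> \<cdot> s \<cdot> rg t \<in> E"
      using G by (simp add: mult_idempotents rg_idempotent source_idempotent)
    ultimately have "s\<^sup>\<star> \<cdot> (s \<cdot> rg t) = rg (s\<^sup>\<star> \<cdot> (s \<cdot> rg t))" using rg_of_idempotent by simp
    also have "\<dots> = rg (s\<^sup>\<star> \<cdot> (s \<cdot> t))"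
      using G r by (intro rg_mult_cong) (simp_all add: closed rg_rg)
    finally show ?thesis .
  qed
  finally show ?thesis using G by (auto simp: expansion_gen_gen)
qed

lemma expansion_regular:
  assumes "s \<in> G"
  shows "expansion_gen s \<otimes> expansion_gen (s\<^sup>\<star>) \<otimes> expansion_gen s = expansion_gen s"
proof -
  note G = assms star_closed[OF assms] rg_closed[OF assms]
  have 1: "expansion_gen s \<otimes> expansion_gen (s\<^sup>\<star>) = (rg s, {rg s, s})"
    using G by (auto simp: expansion_gen_gen rg_rg star_star) (simp_all add: star_inverse flip: assoc)
  have "rg s \<cdot> rg s = rg s" using G by (simp add: idempotents_idem rg_idempotent)
  then show ?thesis
    unfolding 1 using G by (auto simp: expansion_mult_def expansion_gen_def rg_mult_self)
qed

text \<open>Translation by \<open>a\<^sup>\<star>\<close> and back by \<open>a\<close> fixes every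
  element with the range of \<open>a\<close>, so only \<open>a\<close> and its range are added to
  \<open>B\<close>. Sets over \<open>t\<close> can thus be built up one element at a time.\<close>

lemma expansion_eps:
  assumes a: "a \<in> G" "rg a = rg t" and t: "t \<in> G" and B: "B \<subseteq> range_fibre G mult (rg t)"
  shows "expansion_gen a \<otimes> (expansion_gen (a\<^sup>\<star>) \<otimes> (t, B)) = (t, {rg t, a} \<union> B)"
proof -
  note G = assms(1,3) star_closed[OF a(1)]
  have at: "a \<cdot> (a\<^sup>\<star> \<cdot> t) = t" using G a by (simp add: rg_mult_self flip: assoc)
  have r: "rg (a\<^sup>\<star> \<cdot> t) = a\<^sup>\<star> \<cdot> a"
  proof -
    have "rg (a\<^sup>\<star> \<cdot> t) = rg (a\<^sup>\<star> \<cdot> a)" using G a by (intro rg_mult_cong) simp_all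
    then show ?thesis using G by (simp add: rg_of_idempotent source_idempotent)
  qed
  have B': "a \<cdot> (a\<^sup>\<star> \<cdot> b) = b" if "b \<in> B" for b
  proof -
    have "b \<in> G" "rg b = rg t" using that B by (auto simp: range_fibre_def)
    then show ?thesis using G a rg_absorb[of b t] by (simp flip: assoc)
  qed
  have "expansion_gen (a\<^sup>\<star>) \<otimes> (t, B) = (a\<^sup>\<star> \<cdot> t, {a\<^sup>\<star> \<cdot> a, a\<^sup>\<star>} \<union> (\<cdot>) (a\<^sup>\<star>) ` B)"
    using G by (auto simp: expansion_gen_mult r star_inverse)
  also have "expansion_gen a \<otimes> \<dots> = (t, {rg t, a} \<union> B)"
  proof -
    have "(\<cdot>) a ` (\<cdot>) (a\<^sup>\<star>) ` B = B" using B' by (simp add: image_image)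
    moreover have "a \<cdot> (a\<^sup>\<star> \<cdot> a) = a" using G by (simp add: star_inverse flip: assoc)
    moreover have "rg t \<cdot> a = a" using G a by (intro rg_absorb) simp_all
    ultimately show ?thesis
      using G a(2) by (auto simp: expansion_gen_mult closed at)
  qed
  finally show ?thesis .
qed

end

section \<open>Normal forms of words\<close>

context operator_representation
begin

text \<open>The induction builds a list of indices in step with the set that \<open>g\<close>
  assigns to the word. At a new letter \<open>s\<close>, \<open>T_foldr_eps\<close> translates the
  old indices and \<open>T_mult\<close> supplies two new ones, just as
  \<open>expansion_gen_mult\<close> does for the set.\<close>

lemma foldr_T_normal_form:
  assumes g_gen: "\<And>s. s \<in> G \<Longrightarrow> g [s] = expansion_gen s"
    and g_Cons: "\<And>s w. s \<in> G \<Longrightarrow> w \<in> words G \<Longrightarrow> g (s # w) = expansion_gen s \<otimes> g w"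
    and w: "w \<in> words G"
  shows "\<exists>t xs. t \<in> G \<and> set xs \<subseteq> G \<and> g w = (t, set xs)
    \<and> (\<forall>X. foldr T w X = foldr eps xs (T t X))"
proof -
  have "w \<noteq> []" "w \<in> lists G" using w by (auto simp: words_def)
  then show ?thesis
  proof (induction w rule: list_nonempty_induct)
    case (single s)
    then have s: "s \<in> G" by simp
    \<comment> \<open>The indices that \<open>expansion_gen s\<close> prescribes are redundant in
      front of \<open>T s\<close>.\<close>
    have "foldr eps [rg s, s] (T s X) = T s X" for X
      using s by (simp add: eps_idempotent rg_idempotent T_rg T_rg_eps) (simp add: eps_def T_regular)
    then show ?case using s g_gen[OF s]
      by (intro exI[of _ s] exI[of _ "[rg s, s]"]) (simp add: expansion_gen_def rg_closed)
  next
    case (cons s w)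
    then have s: "s \<in> G" and w: "w \<in> words G" by (simp_all add: words_def)
    from cons obtain t xs where IH: "t \<in> G" "set xs \<subseteq> G" "g w = (t, set xs)"
      "\<And>X. foldr T w X = foldr eps xs (T t X)" by auto
    have st: "s \<cdot> t \<in> G" "rg (s \<cdot> t) \<in> G" using s IH by (simp_all add: closed rg_closed)
    define ys where "ys = map ((\<cdot>) s) xs @ [rg (s \<cdot> t), rg (s \<cdot> t) \<cdot> s]"
    have "g (s # w) = (s \<cdot> t, set ys)"
      using g_Cons[OF s w] s IH by (auto simp: expansion_gen_mult ys_def)
    moreover have "set ys \<subseteq> G" using s IH(2) st by (auto simp: ys_def closed)
    moreover have "foldr T (s # w) X = foldr eps ys (T (s \<cdot> t) X)" for X
      using s IH st by (simp add: ys_def T_foldr_eps T_mult)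
    ultimately show ?case using st by blast
  qed
qed

text \<open>Normal forms with the same pair differ only in the list that enumerates the set.\<close>

lemma foldr_T_eqI:
  assumes "\<And>s. s \<in> G \<Longrightarrow> g [s] = expansion_gen s"
    and "\<And>s w. s \<in> G \<Longrightarrow> w \<in> words G \<Longrightarrow> g (s # w) = expansion_gen s \<otimes> g w"
    and "v \<in> words G" "w \<in> words G" "g v = g w"
  shows "foldr T v X = foldr T w X"
  using foldr_T_normal_form[of g v] foldr_T_normal_form[of g w] assms foldr_eps_cong_set
  by (metis prod.inject)

end

section \<open>The action of words on sets of words\<close>

context inverse_semigroup
begin

text \<open>Left multiplication by \<open>[s]\<close>, saturated under the congruence. Accepting
  arbitrary sets makes it a total function, as \<open>operator_representation\<close> demands;
  \<open>lists G\<close> admits the empty word, on which \<open>cls_eqI\<close> relies.\<close>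

definition cons_op :: "'a \<Rightarrow> 'a list set \<Rightarrow> 'a list set" where
  "cons_op s X = {v. \<exists>x\<in>X \<inter> lists G. pr_eq G mult v (s # x)}"

lemma pr_eq_append_right:
  assumes "pr_eq G mult v w" "x \<in> lists G"
  shows "pr_eq G mult (v @ x) (w @ x)"
proof (cases "x = []")
  case False
  then show ?thesis using assms by (intro pr_eq.append pr_eq.refl) (simp_all add: words_def)
qed (use assms in simp)

lemma pr_eq_Cons:
  assumes "pr_eq G mult v w" "s \<in> G"
  shows "pr_eq G mult (s # v) (s # w)"
  using pr_eq.append[OF pr_eq.refl[of "[s]"] assms(1)] assms(2) by (simp add: words_def)

lemma foldr_cons_op:
  assumes "w \<in> words G"
  shows "foldr cons_op w X = {v. \<exists>x\<in>X \<inter> lists G. pr_eq G mult v (w @ x)}"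
proof -
  have "w \<noteq> []" "w \<in> lists G" using assms by (auto simp: words_def)
  then show ?thesis
  proof (induction w rule: list_nonempty_induct)
    case (cons s w)
    then have s: "s \<in> G" and w: "w \<in> words G" by (simp_all add: words_def)
    have foldr_Cons: "foldr cons_op (s # w) X
      = cons_op s {v. \<exists>x\<in>X \<inter> lists G. pr_eq G mult v (w @ x)}"
      using cons by simp
    show ?case
    proof (intro set_eqI iffI)
      fix v assume "v \<in> foldr cons_op (s # w) X"
      then obtain y x where "x \<in> X \<inter> lists G" "pr_eq G mult y (w @ x)" "pr_eq G mult v (s # y)"
        unfolding foldr_Cons cons_op_def by blast
      then show "v \<in> {v. \<exists>x\<in>X \<inter> lists G. pr_eq G mult v ((s # w) @ x)}"
        using pr_eq.trans[OF _ pr_eq_Cons[OF _ s]] by auto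
    next
      fix v assume "v \<in> {v. \<exists>x\<in>X \<inter> lists G. pr_eq G mult v ((s # w) @ x)}"
      then obtain x where x: "x \<in> X \<inter> lists G" "pr_eq G mult v (s # w @ x)" by auto
      moreover have "pr_eq G mult (w @ x) (w @ x)" "w @ x \<in> lists G"
        using x w by (auto intro!: pr_eq.refl simp: words_def)
      ultimately show "v \<in> foldr cons_op (s # w) X"
        unfolding foldr_Cons cons_op_def by blast
    qed
  qed (simp add: cons_op_def)
qed

text \<open>The congruence is compatible with appending words. Applied to a defining relation, this
  yields the corresponding axiom of \<open>operator_representation\<close>.\<close>

lemma foldr_cons_op_cong:
  assumes "pr_eq G mult v w"
  shows "foldr cons_op v X = foldr cons_op w X"
proof -
  have "v \<in> words G" "w \<in> words G" using pr_eq_words[OF assms] by auto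
  then show ?thesis
    using pr_eq_append_right[OF assms] pr_eq_append_right[OF pr_eq.sym[OF assms]]
    by (auto simp: foldr_cons_op intro: pr_eq.trans)
qed

sublocale cons_op: operator_representation G mult cons_op
proof
  fix s t X assume "s \<in> G" "t \<in> G"
  then show "cons_op s (cons_op t (cons_op (t\<^sup>\<star>) X)) = cons_op (s \<cdot> t) (cons_op (t\<^sup>\<star>) X)"
    and "cons_op (s\<^sup>\<star>) (cons_op s (cons_op t X)) = cons_op (s\<^sup>\<star>) (cons_op (s \<cdot> t) X)"
    using foldr_cons_op_cong[OF pr_eq.rel_right, of s t X]
      foldr_cons_op_cong[OF pr_eq.rel_left, of s t X] by simp_all
next
  fix s X assume "s \<in> G"
  then show "cons_op s (cons_op (s\<^sup>\<star>) (cons_op s X)) = cons_op s X"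
    using foldr_cons_op_cong[OF pr_eq.rel_regular, of s X] by simp
qed

section \<open>The isomorphism of \<open>Pr G mult\<close> with \<open>expansion\<close>\<close>

definition cls :: "'a list \<Rightarrow> 'a list set" where
  "cls w = pr_rel G mult `` {w}"

lemma Pr_eq_image: "Pr G mult = cls ` words G"
  by (auto simp: Pr_def quotient_def cls_def)

text \<open>Applied to \<open>{[]}\<close>, the operator of a word returns the class of that word,
  so the action is faithful.\<close>

lemma cls_eqI:
  assumes "v \<in> words G" "w \<in> words G" "foldr cons_op v {[]} = foldr cons_op w {[]}"
  shows "cls v = cls w"
proof -
  have "pr_eq G mult v v" using assms by (intro pr_eq.refl)
  then have "pr_eq G mult v w" using assms by (auto simp: foldr_cons_op)
  then show ?thesis using equiv_class_eq[OF equiv_pr_rel] by (simp add: cls_def pr_rel_def)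
qed

text \<open>The homomorphism comes from \<open>pr_universal\<close>. It is injective because the
  pair of a word determines its operator by \<open>foldr_T_eqI\<close>, and the operator determines
  the class. Surjectivity rests on \<open>expansion_eps\<close>.\<close>

lemma Pr_iso_expansion:
  assumes "finite G"
  obtains f where "bij_betw f (Pr G mult) expansion"
    and "\<And>X Y. X \<in> Pr G mult \<Longrightarrow> Y \<in> Pr G mult \<Longrightarrow> f (pr_mult G mult X Y) = f X \<otimes> f Y"
proof -
  have "\<exists>f. (\<forall>X\<in>Pr G mult. f X \<in> expansion) \<and> (\<forall>s\<in>G. f (pr_gen G mult s) = expansion_gen s) \<and>
      (\<forall>X\<in>Pr G mult. \<forall>Y\<in>Pr G mult. f (pr_mult G mult X Y) = f X \<otimes> f Y)"
    by (rule pr_universal) (fact expansion_mult_closed expansion_mult_assoc expansion_gen_closed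
      expansion_right expansion_left expansion_regular)+
  then obtain f where f: "\<And>X. X \<in> Pr G mult \<Longrightarrow> f X \<in> expansion"
    "\<And>s. s \<in> G \<Longrightarrow> f (pr_gen G mult s) = expansion_gen s"
    "\<And>X Y. X \<in> Pr G mult \<Longrightarrow> Y \<in> Pr G mult \<Longrightarrow> f (pr_mult G mult X Y) = f X \<otimes> f Y"
    by blast
  define g where "g w = f (cls w)" for w
  have g_gen: "g [s] = expansion_gen s" if "s \<in> G" for s
    using f(2)[OF that] by (simp add: g_def cls_def pr_gen_def)
  have g_Cons: "g (s # w) = expansion_gen s \<otimes> g w" if "s \<in> G" "w \<in> words G" for s w
  proof -
    have s: "[s] \<in> words G" using that by (simp add: words_def)
    then have "g (s # w) = f (pr_mult G mult (cls [s]) (cls w))"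
      using pr_mult_classes[OF s that(2)] by (simp add: g_def cls_def)
    then show ?thesis using s that g_gen[OF that(1)] by (simp add: f(3) Pr_eq_image g_def)
  qed
  have "inj_on f (Pr G mult)"
  proof (rule inj_onI)
    fix X Y assume "X \<in> Pr G mult" "Y \<in> Pr G mult" "f X = f Y"
    then obtain v w where "v \<in> words G" "w \<in> words G" "X = cls v" "Y = cls w" "g v = g w"
      by (auto simp: Pr_eq_image g_def)
    then show "X = Y"
      using cls_eqI cons_op.foldr_T_eqI[of g, OF g_gen g_Cons] by metis
  qed
  moreover have "expansion \<subseteq> f ` Pr G mult"
  proof
    fix y assume "y \<in> expansion"
    then obtain t A where y: "y = (t, A)" "t \<in> G" "{rg t, t} \<subseteq> A" "A \<subseteq> range_fibre G mult (rg t)"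
      by (auto simp: expansion_def)
    \<comment> \<open>Finiteness of \<open>G\<close> enters here: a word can insert only finitely
      many elements into the set.\<close>
    then have "finite A" using assms by (auto simp: range_fibre_def intro: finite_subset)
    then obtain xs where xs: "set xs = A" using finite_list by blast
    \<comment> \<open>The word \<open>[t]\<close> yields the least set over \<open>t\<close>;
      prefixing \<open>a\<close> and \<open>a\<^sup>\<star>\<close> inserts
      \<open>a\<close>.\<close>
    have word: "\<exists>w\<in>words G. g w = (t, {rg t, t} \<union> set xs)" if "set xs \<subseteq> range_fibre G mult (rg t)" for xs
      using that
    proof (induction xs)
      case Nil
      then show ?case using y(2) g_gen[of t]
        by (intro bexI[of _ "[t]"]) (auto simp: expansion_gen_def words_def)
    next
      case (Cons a xs)
      then obtain w where w: "w \<in> words G" "g w = (t, {rg t, t} \<union> set xs)" by auto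
      have a: "a \<in> G" "rg a = rg t" using Cons.prems by (auto simp: range_fibre_def)
      have aw: "a\<^sup>\<star> # w \<in> words G" using a w by (simp add: words_def star_closed)
      have "g (a # a\<^sup>\<star> # w) = expansion_gen a \<otimes> (expansion_gen (a\<^sup>\<star>) \<otimes> g w)"
        using g_Cons a w aw star_closed by simp
      also have "\<dots> = (t, {rg t, a} \<union> ({rg t, t} \<union> set xs))"
        unfolding w(2) using a y Cons.prems by (intro expansion_eps) auto
      also have "\<dots> = (t, {rg t, t} \<union> set (a # xs))" by auto
      finally show ?case using a aw by (intro bexI[of _ "a # a\<^sup>\<star> # w"]) (simp_all add: words_def)
    qed
    have "{rg t, t} \<union> set xs = A" using xs y by auto
    then obtain w where "w \<in> words G" "g w = y" using word[of xs] xs y by auto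
    then show "y \<in> f ` Pr G mult" by (auto simp: Pr_eq_image g_def)
  qed
  ultimately have "bij_betw f (Pr G mult) expansion" using f(1) by (auto simp: bij_betw_def)
  then show ?thesis using that f(3) by blast
qed

text \<open>An idempotent \<open>t\<close> equals \<open>rg t\<close> and fixes its fibre pointwise
  from the left, so both parts of the set of the square are \<open>A\<close>.\<close>

lemma expansion_idempotent_iff:
  assumes "x \<in> expansion"
  shows "x \<otimes> x = x \<longleftrightarrow> fst x \<in> E"
proof
  assume "x \<otimes> x = x"
  then have "fst x \<cdot> fst x = fst x" by (metis expansion_mult_def fst_conv)
  then show "fst x \<in> E" using assms by (auto simp: idempotents_def expansion_def)
next
  assume e: "fst x \<in> E"
  obtain t A where x: "x = (t, A)" by fastforce
  have t: "t \<in> E" "t \<in> G" "rg t = t" "t \<cdot> t = t"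
    using e x by (simp_all add: rg_of_idempotent idempotents_in idempotents_idem)
  have "t \<cdot> a = a" if "a \<in> A" for a
    using that assms x t rg_absorb[of a t] by (auto simp: expansion_def range_fibre_def)
  then have "(\<cdot>) t ` A = A" by simp
  then show "x \<otimes> x = x" using t by (simp add: expansion_mult_def x)
qed

text \<open>An idempotent is its own range. Hence each fibre contains one less than its size of
  non-idempotents.\<close>

lemma fibre_idempotents:
  assumes "e \<in> E"
  shows "range_fibre G mult e \<inter> E = {e}"
  using assms rg_of_idempotent by (auto simp: range_fibre_def idempotents_in)

end

section \<open>Counting pairs\<close>

lemma card_sets_between:
  assumes "finite F" "S \<subseteq> F"
  shows "finite {A. S \<subseteq> A \<and> A \<subseteq> F}" "card {A. S \<subseteq> A \<and> A \<subseteq> F} = 2 ^ (card F - card S)"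
proof -
  show "finite {A. S \<subseteq> A \<and> A \<subseteq> F}" by (rule finite_subset[of _ "Pow F"]) (use assms in auto)
  have "bij_betw (\<lambda>B. B \<union> S) (Pow (F - S)) {A. S \<subseteq> A \<and> A \<subseteq> F}"
    by (rule bij_betw_byWitness[where f' = "\<lambda>A. A - S"]) (use assms in auto)
  then have "card {A. S \<subseteq> A \<and> A \<subseteq> F} = card (Pow (F - S))" by (simp add: bij_betw_same_card)
  then show "card {A. S \<subseteq> A \<and> A \<subseteq> F} = 2 ^ (card F - card S)"
    using assms by (simp add: card_Pow card_Diff_subset finite_subset)
qed

context inverse_semigroup
begin

lemma finite_range_fibre: "finite G \<Longrightarrow> finite (range_fibre G mult e)"
  by (simp add: range_fibre_def)

text \<open>The exponent keeps \<open>card {rg t, t}\<close> because this is 1 for idempotent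
  \<open>t\<close> and 2 for all other \<open>t\<close>; both counts below are instances.\<close>

lemma finite_card_expansion_over:
  assumes "finite G" "D \<subseteq> G"
  shows "finite {x \<in> expansion. fst x \<in> D}"
    and "card {x \<in> expansion. fst x \<in> D}
      = (\<Sum>t\<in>D. 2 ^ (card (range_fibre G mult (rg t)) - card {rg t, t}))"
proof -
  have D: "finite D" using assms finite_subset by blast
  have *: "{x \<in> expansion. fst x \<in> D}
    = (SIGMA t:D. {A. {rg t, t} \<subseteq> A \<and> A \<subseteq> range_fibre G mult (rg t)})"
    using assms(2) by (auto simp: expansion_def)
  have sub: "{rg t, t} \<subseteq> range_fibre G mult (rg t)" if "t \<in> D" for t
    using that assms(2) by (auto simp: range_fibre_def rg_closed rg_rg)
  note between = card_sets_between[OF finite_range_fibre[OF assms(1)] sub]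
  show "finite {x \<in> expansion. fst x \<in> D}"
    unfolding * using D between(1) by (rule finite_SigmaI)
  show "card {x \<in> expansion. fst x \<in> D}
      = (\<Sum>t\<in>D. 2 ^ (card (range_fibre G mult (rg t)) - card {rg t, t}))"
    unfolding * using D between by (subst card_SigmaI) (simp_all del: insert_subset)
qed

lemma card_expansion_idempotent:
  assumes "finite G"
  shows "card {x \<in> expansion. fst x \<in> E} = (\<Sum>e\<in>E. 2 ^ (card (range_fibre G mult e) - 1))"
proof -
  have "E \<subseteq> G" using idempotents_in by blast
  then show ?thesis
    using finite_card_expansion_over(2)[OF assms] by (simp add: rg_of_idempotent)
qed

text \<open>Where the fibre is \<open>{e}\<close>, the exponent is truncated to 0, which is harmless
  because the factor in front of it vanishes.\<close>

lemma card_expansion_nonidempotent: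
  assumes "finite G"
  shows "card {x \<in> expansion. fst x \<notin> E}
    = (\<Sum>e\<in>E. (card (range_fibre G mult e) - 1) * 2 ^ (card (range_fibre G mult e) - 2))"
proof -
  have E: "finite E" using assms by (simp add: idempotents_def)
  have "{x \<in> expansion. fst x \<notin> E} = {x \<in> expansion. fst x \<in> G - E}"
    by (auto simp: expansion_def)
  also have "card \<dots> = (\<Sum>t\<in>G - E. 2 ^ (card (range_fibre G mult (rg t)) - card {rg t, t}))"
    using assms by (rule finite_card_expansion_over) auto
  also have "\<dots> = (\<Sum>t\<in>G - E. 2 ^ (card (range_fibre G mult (rg t)) - 2))"
  proof (rule sum.cong)
    fix t assume "t \<in> G - E"
    then have "rg t \<noteq> t" using rg_idempotent by force
    then show "2 ^ (card (range_fibre G mult (rg t)) - card {rg t, t})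
      = (2 ^ (card (range_fibre G mult (rg t)) - 2) :: nat)" by simp
  qed simp
  \<comment> \<open>Grouped by range, the summand is constant on each group, and
    \<open>fibre_idempotents\<close> gives the size of the group.\<close>
  also have "\<dots> = (\<Sum>e\<in>E. \<Sum>t\<in>{t \<in> G - E. rg t = e}. 2 ^ (card (range_fibre G mult (rg t)) - 2))"
    using assms E by (intro sum.group[symmetric]) (auto simp: rg_idempotent)
  also have "\<dots> = (\<Sum>e\<in>E. (card (range_fibre G mult e) - 1) * 2 ^ (card (range_fibre G mult e) - 2))"
  proof (rule sum.cong)
    fix e assume e: "e \<in> E"
    have "{t \<in> G - E. rg t = e} = range_fibre G mult e - {e}"
      using fibre_idempotents[OF e] by (auto simp: range_fibre_def)
    moreover have "e \<in> range_fibre G mult e" using fibre_idempotents[OF e] by blast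
    ultimately have "card {t \<in> G - E. rg t = e} = card (range_fibre G mult e) - 1" by simp
    then show "(\<Sum>t\<in>{t \<in> G - E. rg t = e}. 2 ^ (card (range_fibre G mult (rg t)) - 2))
      = (card (range_fibre G mult e) - 1) * 2 ^ (card (range_fibre G mult e) - 2)" by simp
  qed simp
  finally show ?thesis .
qed

text \<open>As \<open>f\<close> is injective and multiplicative, it matches idempotents with the
  pairs whose first component is idempotent, and non-idempotents with the rest.\<close>

lemma card_Pr:
  assumes "finite G"
  shows "finite (Pr G mult)"
    and "card (idempotents (Pr G mult) (pr_mult G mult))
      = (\<Sum>e\<in>E. 2 ^ (card (range_fibre G mult e) - 1))"
    and "card (Pr G mult - idempotents (Pr G mult) (pr_mult G mult))
      = (\<Sum>e\<in>E. (card (range_fibre G mult e) - 1) * 2 ^ (card (range_fibre G mult e) - 2))"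
proof -
  obtain f where f: "bij_betw f (Pr G mult) expansion"
    and hom: "\<And>X Y. X \<in> Pr G mult \<Longrightarrow> Y \<in> Pr G mult \<Longrightarrow> f (pr_mult G mult X Y) = f X \<otimes> f Y"
    using Pr_iso_expansion[OF assms] by blast
  have inj: "inj_on f (Pr G mult)" and img: "f ` Pr G mult = expansion"
    using f by (auto simp: bij_betw_def)
  \<comment> \<open>Injectivity of \<open>f\<close> is known on \<open>Pr G mult\<close> only, so
    squares must be shown to lie there.\<close>
  have closed_Pr: "pr_mult G mult X X \<in> Pr G mult" if X: "X \<in> Pr G mult" for X
  proof -
    obtain w where w: "w \<in> words G" "X = cls w" using X by (auto simp: Pr_eq_image)
    moreover from w have "w @ w \<in> words G" by (simp add: words_def)
    ultimately show ?thesis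
      using pr_mult_classes[OF w(1) w(1)] by (simp add: Pr_eq_image flip: cls_def)
  qed
  have idem: "pr_mult G mult X X = X \<longleftrightarrow> fst (f X) \<in> E" if X: "X \<in> Pr G mult" for X
  proof -
    have "pr_mult G mult X X = X \<longleftrightarrow> f X \<otimes> f X = f X"
      using inj_on_eq_iff[OF inj closed_Pr[OF X] X] hom[OF X X] by simp
    also have "\<dots> \<longleftrightarrow> fst (f X) \<in> E" using expansion_idempotent_iff img X by blast
    finally show ?thesis .
  qed
  have "expansion = {x \<in> expansion. fst x \<in> G}" by (auto simp: expansion_def)
  then have "finite expansion" using finite_card_expansion_over(1)[OF assms, of G] by simp
  then show "finite (Pr G mult)" using bij_betw_finite[OF f] by simp
  have EPr: "idempotents (Pr G mult) (pr_mult G mult) = {X \<in> Pr G mult. fst (f X) \<in> E}"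
    unfolding idempotents_def[of "Pr G mult"] using idem by blast
  have img_idempotent: "f ` idempotents (Pr G mult) (pr_mult G mult) = {x \<in> expansion. fst x \<in> E}"
    unfolding EPr img[symmetric] by blast
  have inj_idempotent: "inj_on f (idempotents (Pr G mult) (pr_mult G mult))"
    by (rule inj_on_subset[OF inj]) (auto simp: idempotents_def)
  show "card (idempotents (Pr G mult) (pr_mult G mult))
      = (\<Sum>e\<in>E. 2 ^ (card (range_fibre G mult e) - 1))"
    unfolding card_image[OF inj_idempotent, symmetric] img_idempotent
    using assms by (rule card_expansion_idempotent)
  have img_nonidempotent: "f ` (Pr G mult - idempotents (Pr G mult) (pr_mult G mult)) = {x \<in> expansion. fst x \<notin> E}"
    unfolding EPr img[symmetric] by blast
  have inj_nonidempotent: "inj_on f (Pr G mult - idempotents (Pr G mult) (pr_mult G mult))"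
    by (rule inj_on_subset[OF inj]) auto
  show "card (Pr G mult - idempotents (Pr G mult) (pr_mult G mult))
      = (\<Sum>e\<in>E. (card (range_fibre G mult e) - 1) * 2 ^ (card (range_fibre G mult e) - 2))"
    unfolding card_image[OF inj_nonidempotent, symmetric] img_nonidempotent
    using assms by (rule card_expansion_nonidempotent)
qed

end

section \<open>Integer exponents and the total count\<close>

theorem proposition5p12:
  fixes G :: "'a set" and mult :: "'a \<Rightarrow> 'a \<Rightarrow> 'a" and p :: "'a \<Rightarrow> nat"
    and E :: "'a set" and PrG EPr :: "'a list set set"
  assumes "inverse_semigroup G mult"
    and "finite G"
  defines "E \<equiv> idempotents G mult"
    and "p \<equiv> (\<lambda>e. card (range_fibre G mult e))"
    and "PrG \<equiv> Pr G mult"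
    and "EPr \<equiv> idempotents (Pr G mult) (pr_mult G mult)"
  shows "finite PrG
    \<and> real (card EPr) = (\<Sum>e\<in>E. 2 powi (int (p e) - 1))
    \<and> real (card (PrG - EPr)) = (\<Sum>e\<in>E. 2 powi (int (p e) - 2) * (real (p e) - 1))
    \<and> real (card PrG) = (\<Sum>e\<in>E. 2 powi (int (p e) - 1))
        + (\<Sum>e\<in>E. 2 powi (int (p e) - 2) * (real (p e) - 1))
    \<and> (\<Sum>e\<in>E. 2 powi (int (p e) - 1))
        + (\<Sum>e\<in>E. 2 powi (int (p e) - 2) * (real (p e) - 1))
      = (\<Sum>e\<in>E. 2 powi (int (p e) - 2) * (real (p e) + 1))"
proof -
  interpret inverse_semigroup G mult by fact
  \<comment> \<open>Each \<open>e\<close> lies in its own fibre; hence the natural exponent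
    \<open>p e - 1\<close> is not truncated and agrees with the integer one.\<close>
  have p: "p e \<ge> 1" if "e \<in> E" for e
  proof -
    have "e \<in> range_fibre G mult e" using fibre_idempotents[of e] that by (auto simp: E_def)
    then show ?thesis
      using finite_range_fibre[OF assms(2)] by (auto simp: p_def Suc_le_eq card_gt_0_iff)
  qed
  have fin: "finite PrG" unfolding PrG_def using assms(2) by (rule card_Pr)
  have idem: "real (card EPr) = (\<Sum>e\<in>E. 2 powi (int (p e) - 1))"
  proof -
    have "card EPr = (\<Sum>e\<in>E. 2 ^ (p e - 1))"
      unfolding EPr_def E_def p_def using assms(2) by (rule card_Pr)
    moreover have "2 powi (int (p e) - 1) = (2 ^ (p e - 1) :: real)" if "e \<in> E" for e
      using p[OF that] by (simp add: power_int_def nat_diff_distrib)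
    ultimately show ?thesis by simp
  qed
  have nonidem: "real (card (PrG - EPr)) = (\<Sum>e\<in>E. 2 powi (int (p e) - 2) * (real (p e) - 1))"
  proof -
    have "card (PrG - EPr) = (\<Sum>e\<in>E. (p e - 1) * 2 ^ (p e - 2))"
      unfolding PrG_def EPr_def E_def p_def using assms(2) by (rule card_Pr)
    moreover have "2 powi (int (p e) - 2) * (real (p e) - 1) = real ((p e - 1) * 2 ^ (p e - 2))"
      if "e \<in> E" for e
    \<comment> \<open>For \<open>p e = 1\<close> the integer exponent is -1 and the natural one is
      truncated to 0, but the factor \<open>p e - 1\<close> makes both sides vanish.\<close>
    proof (cases "p e = 1")
      case False
      then have "p e \<ge> 2" using p[OF that] by simp
      then show ?thesis by (simp add: power_int_def nat_diff_distrib of_nat_diff)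
    qed simp
    ultimately show ?thesis by simp
  qed
  have "card PrG = card EPr + card (PrG - EPr)"
    using fin by (subst card_Un_disjoint[symmetric])
      (auto simp: EPr_def PrG_def idempotents_def intro: arg_cong[of _ _ card] finite_subset)
  then have total: "real (card PrG) = (\<Sum>e\<in>E. 2 powi (int (p e) - 1))
      + (\<Sum>e\<in>E. 2 powi (int (p e) - 2) * (real (p e) - 1))"
    using idem nonidem by simp
  \<comment> \<open>With this, the summands combine by
    \<open>2 + (p e - 1) = p e + 1\<close>.\<close>
  have "2 powi (int (p e) - 1) = 2 * (2 powi (int (p e) - 2) :: real)" for e
    using power_int_add[of "2 :: real" 1 "int (p e) - 2"] by simp
  then have "(\<Sum>e\<in>E. 2 powi (int (p e) - 1))
      + (\<Sum>e\<in>E. 2 powi (int (p e) - 2) * (real (p e) - 1))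
    = (\<Sum>e\<in>E. 2 powi (int (p e) - 2) * (real (p e) + 1))"
    by (simp add: algebra_simps flip: sum.distrib)
  with fin idem nonidem total show ?thesis by simp
qed

end
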